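(* Let $(\mathfrak g,\mu,T,B)$ be a quadratic Hom-Lie algebra over $\mathbb F$ with $T$ in its centroid and $\dim\operatorname{Ker}(T)>0$. Let $V$ be a vector space with $\dim V=\dim\operatorname{Ker}(T)$, and let $(\mathfrak G=\mathfrak g\oplus V,[\,\cdot\,,\,\cdot\,]_{\mathfrak G},B_{\mathfrak G})$ be the quadratic Lie algebra, $(\mathfrak G,\mu_{\mathfrak G},L)$ the Hom-Lie algebra, and $h:\mathfrak G\to\mathfrak g$ the linear map constructed in the context. Then there is a bilinear product $\mathfrak G\times\mathfrak G\to\mathfrak G$, $(x,y)\mapsto xy$, such that: (i) $\mu_{\mathfrak G}(x,y)=xy-yx$ for all $x,y\in\mathfrak G$; (ii) $2\,xy=\mu_{\mathfrak G}(x,y)-[h(x),y]_{\mathfrak G}+[x,h(y)]_{\mathfrak G}$ for all $x,y\in\mathfrak G$; (iii) $x^2=0$ for all $x\in\operatorname{Ker}(h)\cup\operatorname{Im}(L)$, and $\mathfrak G=\operatorname{Ker}(h)\oplus\operatorname{Im}(L)$.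
   Context: All vector spaces are finite dimensional over an algebraically closed field $\mathbb F$ of characteristic zero. A Hom-Lie algebra is a triple $(\mathfrak g,\mu,T)$ with $\mathfrak g$ a vector space, $\mu:\mathfrak g\times\mathfrak g\to\mathfrak g$ bilinear and skew-symmetric, and $T:\mathfrak g\to\mathfrak g$ linear, such that $\mu(T(x),\mu(y,z))+\mu(T(y),\mu(z,x))+\mu(T(z),\mu(x,y))=0$ for all $x,y,z\in\mathfrak g$. $T$ is in the centroid of $(\mathfrak g,\mu)$ if $T(\mu(x,y))=\mu(T(x),y)$ for all $x,y$. A quadratic Hom-Lie algebra $(\mathfrak g,\mu,T,B)$ is a Hom-Lie algebra with a symmetric non-degenerate bilinear form $B$ on $\mathfrak g$ such that $B(\mu(x,y),z)=B(x,\mu(y,z))$ and $B(T(x),y)=B(x,T(y))$ for all $x,y,z$. Construction, with $r=\dim\operatorname{Ker}(T)$. Choose a subspace $\mathfrak a\subset\mathfrak g$ complementary to $\operatorname{Im}(T)$ (so $\dim\mathfrak a=r$), a basis $a_1,\dots,a_r$ of $\mathfrak a$ and a basis $v_1,\dots,v_r$ of $V$. Define $k:\mathfrak g\to\mathfrak G$ by $k(x)=T(x)+B(a_1,x)v_1+\cdots+B(a_r,x)v_r$, and $[x+u,y+v]_{\mathfrak G}=k(\mu(x,y))$ for $x,y\in\mathfrak g$, $u,v\in V$. Define the symmetric bilinear form $B_{\mathfrak G}$ on $\mathfrak G=\mathfrak a\oplus\operatorname{Im}(T)\oplus V$ by $B_{\mathfrak G}(T(x),T(y))=B(T(x),y)$;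 $B_{\mathfrak G}(\mathfrak a\oplus V,\operatorname{Im}(T))=B_{\mathfrak G}(\mathfrak a,\mathfrak a)=B_{\mathfrak G}(V,V)=\{0\}$; $B_{\mathfrak G}(a_i,v_j)=\delta_{ij}$. Then $(\mathfrak G,[\,\cdot\,,\,\cdot\,]_{\mathfrak G},B_{\mathfrak G})$ is a quadratic Lie algebra (a Lie algebra with a non-degenerate symmetric invariant bilinear form). Define $\mu_{\mathfrak G}(x+u,y+v)=\mu(x,y)$ and $L(x+u)=k(x)$ for $x,y\in\mathfrak g$, $u,v\in V$; then $(\mathfrak G,\mu_{\mathfrak G},L)$ is a Hom-Lie algebra. The linear map $h:\mathfrak G\to\mathfrak g$ is the one determined by $B(h(x),y)=B_{\mathfrak G}(x,y)$ for all $x\in\mathfrak G$, $y\in\mathfrak g$. Elements of $\mathfrak g$ are regarded as elements of $\mathfrak G=\mathfrak g\oplus V$. *)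

theory Defs
  imports "HOL-Analysis.Product_Vector" "HOL-Computational_Algebra.Polynomial"
begin

definition finite_dim :: "('f::field \<Rightarrow> 'a::ab_group_add \<Rightarrow> 'a) \<Rightarrow> bool"
  where "finite_dim s \<longleftrightarrow> (\<exists>Basis. finite_dimensional_vector_space s Basis)"

definition bilinear_map ::
  "('f::field \<Rightarrow> 'a::ab_group_add \<Rightarrow> 'a) \<Rightarrow> ('f \<Rightarrow> 'b::ab_group_add \<Rightarrow> 'b) \<Rightarrow>
   ('f \<Rightarrow> 'c::ab_group_add \<Rightarrow> 'c) \<Rightarrow> ('a \<Rightarrow> 'b \<Rightarrow> 'c) \<Rightarrow> bool"
  where "bilinear_map s1 s2 s3 f \<longleftrightarrow>
    (\<forall>x. Vector_Spaces.linear s2 s3 (f x)) \<and> (\<forall>y. Vector_Spaces.linear s1 s3 (\<lambda>x. f x y))"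

abbreviation bilinear_form ::
  "('f::field \<Rightarrow> 'a::ab_group_add \<Rightarrow> 'a) \<Rightarrow> ('a \<Rightarrow> 'a \<Rightarrow> 'f) \<Rightarrow> bool"
  where "bilinear_form s \<equiv> bilinear_map s s (*)"

definition direct_sum_decomp ::
  "('f::field \<Rightarrow> 'a::ab_group_add \<Rightarrow> 'a) \<Rightarrow> 'a set \<Rightarrow> 'a set \<Rightarrow> bool"
  where "direct_sum_decomp s U W \<longleftrightarrow>
    module.subspace s U \<and> module.subspace s W \<and> U \<inter> W = {0} \<and>
    (\<forall>x. \<exists>u\<in>U. \<exists>w\<in>W. x = u + w)"

definition basis_family ::
  "('f::field \<Rightarrow> 'a::ab_group_add \<Rightarrow> 'a) \<Rightarrow> 'a set \<Rightarrow> nat \<Rightarrow> (nat \<Rightarrow> 'a) \<Rightarrow> bool"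
  where "basis_family s W r b \<longleftrightarrow>
    inj_on b {1..r} \<and> \<not> module.dependent s (b ` {1..r}) \<and> module.span s (b ` {1..r}) = W"

definition hom_lie_algebra ::
  "('f::field \<Rightarrow> 'g::ab_group_add \<Rightarrow> 'g) \<Rightarrow> ('g \<Rightarrow> 'g \<Rightarrow> 'g) \<Rightarrow> ('g \<Rightarrow> 'g) \<Rightarrow> bool"
  where "hom_lie_algebra s \<mu> T \<longleftrightarrow>
    finite_dim s \<and> bilinear_map s s s \<mu> \<and> (\<forall>x y. \<mu> x y = - \<mu> y x) \<and>
    Vector_Spaces.linear s s T \<and>
    (\<forall>x y z. \<mu> (T x) (\<mu> y z) + \<mu> (T y) (\<mu> z x) + \<mu> (T z) (\<mu> x y) = 0)"

definition in_centroid :: "('g \<Rightarrow> 'g \<Rightarrow> 'g) \<Rightarrow> ('g \<Rightarrow> 'g) \<Rightarrow> bool"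
  where "in_centroid \<mu> T \<longleftrightarrow> (\<forall>x y. T (\<mu> x y) = \<mu> (T x) y)"

definition quadratic_hom_lie_algebra ::
  "('f::field \<Rightarrow> 'g::ab_group_add \<Rightarrow> 'g) \<Rightarrow> ('g \<Rightarrow> 'g \<Rightarrow> 'g) \<Rightarrow> ('g \<Rightarrow> 'g) \<Rightarrow> ('g \<Rightarrow> 'g \<Rightarrow> 'f) \<Rightarrow> bool"
  where "quadratic_hom_lie_algebra s \<mu> T B \<longleftrightarrow>
    hom_lie_algebra s \<mu> T \<and>
    bilinear_form s B \<and> (\<forall>x y. B x y = B y x) \<and> (\<forall>x. (\<forall>y. B x y = 0) \<longrightarrow> x = 0) \<and>
    (\<forall>x y z. B (\<mu> x y) z = B x (\<mu> y z)) \<and> (\<forall>x y. B (T x) y = B x (T y))"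

text \<open>
  The space \<open>\<GG> = \<gg> \<oplus> V\<close> is the product type \<open>'g \<times> 'v\<close> with scalar multiplication
  \<open>module_prod.scale sg sv\<close>; an element \<open>x\<close> of \<open>\<gg>\<close> is identified with \<open>(x, 0)\<close> and an
  element \<open>u\<close> of \<open>V\<close> with \<open>(0, u)\<close>.
\<close>

definition k_map ::
  "('f::field \<Rightarrow> 'v::ab_group_add \<Rightarrow> 'v) \<Rightarrow> ('g \<Rightarrow> 'g) \<Rightarrow> ('g \<Rightarrow> 'g \<Rightarrow> 'f) \<Rightarrow> nat \<Rightarrow>
   (nat \<Rightarrow> 'g) \<Rightarrow> (nat \<Rightarrow> 'v) \<Rightarrow> 'g \<Rightarrow> 'g \<times> 'v"
  where "k_map sv T B r a v x = (T x, \<Sum>i=1..r. sv (B (a i) x) (v i))"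

definition bracket_G ::
  "('f::field \<Rightarrow> 'v::ab_group_add \<Rightarrow> 'v) \<Rightarrow> ('g \<Rightarrow> 'g \<Rightarrow> 'g) \<Rightarrow> ('g \<Rightarrow> 'g) \<Rightarrow> ('g \<Rightarrow> 'g \<Rightarrow> 'f) \<Rightarrow> nat \<Rightarrow>
   (nat \<Rightarrow> 'g) \<Rightarrow> (nat \<Rightarrow> 'v) \<Rightarrow> 'g \<times> 'v \<Rightarrow> 'g \<times> 'v \<Rightarrow> 'g \<times> 'v"
  where "bracket_G sv \<mu> T B r a v p q = k_map sv T B r a v (\<mu> (fst p) (fst q))"

definition mu_G :: "('g \<Rightarrow> 'g \<Rightarrow> 'g) \<Rightarrow> 'g \<times> 'v::zero \<Rightarrow> 'g \<times> 'v \<Rightarrow> 'g \<times> 'v"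
  where "mu_G \<mu> p q = (\<mu> (fst p) (fst q), 0)"

definition L_map ::
  "('f::field \<Rightarrow> 'v::ab_group_add \<Rightarrow> 'v) \<Rightarrow> ('g \<Rightarrow> 'g) \<Rightarrow> ('g \<Rightarrow> 'g \<Rightarrow> 'f) \<Rightarrow> nat \<Rightarrow>
   (nat \<Rightarrow> 'g) \<Rightarrow> (nat \<Rightarrow> 'v) \<Rightarrow> 'g \<times> 'v \<Rightarrow> 'g \<times> 'v"
  where "L_map sv T B r a v p = k_map sv T B r a v (fst p)"

text \<open>
  The conditions determine \<open>BG\<close> uniquely; existence and uniqueness of \<open>BG\<close>, and of the map
  \<open>h\<close> obtained from it, are \<open>form_G_ex1\<close> and \<open>h_ex1\<close> below.
\<close>

definition is_form_G ::
  "('f::field \<Rightarrow> 'g::ab_group_add \<Rightarrow> 'g) \<Rightarrow> ('f \<Rightarrow> 'v::ab_group_add \<Rightarrow> 'v) \<Rightarrow> ('g \<Rightarrow> 'g) \<Rightarrow>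
   ('g \<Rightarrow> 'g \<Rightarrow> 'f) \<Rightarrow> 'g set \<Rightarrow> nat \<Rightarrow> (nat \<Rightarrow> 'g) \<Rightarrow> (nat \<Rightarrow> 'v) \<Rightarrow>
   ('g \<times> 'v \<Rightarrow> 'g \<times> 'v \<Rightarrow> 'f) \<Rightarrow> bool"
  where "is_form_G sg sv T B \<aa> r a v BG \<longleftrightarrow>
    bilinear_form (module_prod.scale sg sv) BG \<and>
    (\<forall>p q. BG p q = BG q p) \<and>
    (\<forall>x y. BG (T x, 0) (T y, 0) = B (T x) y) \<and>
    (\<forall>x\<in>\<aa>. \<forall>u y. BG (x, u) (T y, 0) = 0) \<and>
    (\<forall>x\<in>\<aa>. \<forall>y\<in>\<aa>. BG (x, 0) (y, 0) = 0) \<and>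
    (\<forall>u w. BG (0, u) (0, w) = 0) \<and>
    (\<forall>i\<in>{1..r}. \<forall>j\<in>{1..r}. BG (a i, 0) (0, v j) = (if i = j then 1 else 0))"

definition is_h_map ::
  "('f::field \<Rightarrow> 'g::ab_group_add \<Rightarrow> 'g) \<Rightarrow> ('f \<Rightarrow> 'v::ab_group_add \<Rightarrow> 'v) \<Rightarrow>
   ('g \<Rightarrow> 'g \<Rightarrow> 'f) \<Rightarrow> ('g \<times> 'v \<Rightarrow> 'g \<times> 'v \<Rightarrow> 'f) \<Rightarrow> ('g \<times> 'v \<Rightarrow> 'g) \<Rightarrow> bool"
  where "is_h_map sg sv B BG h \<longleftrightarrow>
    Vector_Spaces.linear (module_prod.scale sg sv) sg h \<and> (\<forall>p y. B (h p) y = BG p (y, 0))"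

lemma bilinear_mapD:
  assumes "bilinear_map s1 s2 s3 f"
  shows "f x (y + y') = f x y + f x y'" "f (x + x') y = f x y + f x' y"
    "f x (s2 c y) = s3 c (f x y)" "f (s1 c x) y = s3 c (f x y)"
    "f x 0 = 0" "f 0 y = 0"
proof -
  interpret r: Vector_Spaces.linear s2 s3 "f x"
    using assms by (simp add: bilinear_map_def)
  interpret l: Vector_Spaces.linear s1 s3 "\<lambda>x. f x y"
    using assms by (simp add: bilinear_map_def)
  show "f x (y + y') = f x y + f x y'" "f (x + x') y = f x y + f x' y"
    "f x (s2 c y) = s3 c (f x y)" "f (s1 c x) y = s3 c (f x y)"
    "f x 0 = 0" "f 0 y = 0"
    by (simp_all add: r.add l.add r.scale l.scale r.zero l.zero)
qed

lemma Riesz_representation: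
  assumes fd: "finite_dim s" and bil: "bilinear_form s B"
    and nd: "\<And>x. (\<And>y. B x y = 0) \<Longrightarrow> x = 0"
    and f: "Vector_Spaces.linear s (*) f"
  shows "\<exists>x. \<forall>y. B x y = f y"
proof -
  obtain Basis where "finite_dimensional_vector_space s Basis"
    using fd by (auto simp: finite_dim_def)
  then interpret vs: finite_dimensional_vector_space s Basis .
  interpret fl: Vector_Spaces.linear s "(*)" f by fact
  have bl: "Vector_Spaces.linear s (*) (B x)" for x
    using bil by (simp add: bilinear_map_def)
  have ext: "g1 = g2" if "Vector_Spaces.linear s (*) g1" "Vector_Spaces.linear s (*) g2"
      "\<And>b. b \<in> Basis \<Longrightarrow> g1 b = g2 b" for g1 g2
  proof -
    interpret vector_space_pair s "(*) :: 'a \<Rightarrow> 'a \<Rightarrow> 'a" by unfold_locales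
    show ?thesis
      using linear_eq_on_span[OF that(1,2), of Basis] that(3) vs.span_Basis by (intro ext) auto
  qed
  define \<phi> where "\<phi> x = (\<Sum>b\<in>Basis. s (B x b) b)" for x
  have coeff: "c b = d b" if "(\<Sum>b\<in>Basis. s (c b) b) = (\<Sum>b\<in>Basis. s (d b) b)" "b \<in> Basis" for c d b
  proof -
    have "(\<Sum>b\<in>Basis. s (c b - d b) b) = 0"
      using that(1) by (simp add: vs.scale_left_diff_distrib sum_subtractf)
    with vs.independent_Basis vs.finite_Basis that(2) have "c b - d b = 0"
      using vs.independentD[of Basis Basis "\<lambda>b. c b - d b" b] by auto
    then show ?thesis by simp
  qed
  have \<phi>: "Vector_Spaces.linear s s \<phi>"
    unfolding \<phi>_def
    by unfold_locales
       (auto simp: bilinear_mapD[OF bil] vs.scale_left_distrib sum.distrib vs.scale_sum_right)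
  have zero: "x = 0" if "\<phi> x = 0" for x
  proof -
    have "(\<Sum>b\<in>Basis. s (B x b) b) = (\<Sum>b\<in>Basis. s 0 b)" using that by (simp add: \<phi>_def)
    then have "B x b = 0" if "b \<in> Basis" for b using coeff[of "B x" "\<lambda>_. 0"] that by simp
    moreover have "Vector_Spaces.linear s (*) (\<lambda>_. 0 :: 'a)" by unfold_locales auto
    ultimately have "B x = (\<lambda>_. 0)" by (intro ext bl) auto
    then show ?thesis by (intro nd) simp
  qed
  have "inj \<phi>"
    using zero module_hom.inj_iff_eq_0[OF \<phi>[unfolded linear_iff_module_hom]] by blast
  then have "surj \<phi>" by (rule vs.linear_inj_imp_surj[OF \<phi>])
  then obtain x where "\<phi> x = (\<Sum>b\<in>Basis. s (f b) b)" by (metis surjD)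
  then have "B x b = f b" if "b \<in> Basis" for b
    using coeff[of "B x" f b] that by (simp add: \<phi>_def)
  then have "B x = f" by (intro ext bl f)
  then show ?thesis by auto
qed

lemma h_ex1:
  fixes sg :: "'f::field \<Rightarrow> 'g::ab_group_add \<Rightarrow> 'g" and sv :: "'f \<Rightarrow> 'v::ab_group_add \<Rightarrow> 'v"
  assumes q: "quadratic_hom_lie_algebra sg \<mu> T B" and "vector_space sv"
    and BG: "bilinear_form (module_prod.scale sg sv) BG"
  shows "\<exists>!h. is_h_map sg sv B BG h"
proof -
  have bil: "bilinear_form sg B" and fd: "finite_dim sg"
    and nd: "\<And>x. (\<And>y. B x y = 0) \<Longrightarrow> x = 0"
    using q by (auto simp: quadratic_hom_lie_algebra_def hom_lie_algebra_def)
  have "vector_space sg"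
    using fd by (auto simp: finite_dim_def finite_dimensional_vector_space_def)
  then interpret vs: vector_space_prod sg sv
    using \<open>vector_space sv\<close> by (simp add: vector_space_prod_def vector_space_pair_def)
  have sc: "(vs.scale c (x, 0)) = (sg c x, 0)" for c x by (simp add: vs.scale_def)
  have eqI: "x = x'" if "\<And>y. B x y = B x' y" for x x'
  proof -
    have "B (x + sg (-1) x') y = 0" for y
      using that by (simp only: bilinear_mapD[OF bil]) simp
    then have "x + sg (-1) x' = 0" by (rule nd)
    then show ?thesis by simp
  qed
  have lin: "Vector_Spaces.linear sg (*) (\<lambda>y. BG p (y, 0))" for p
  proof -
    have "BG p (x + y, 0) = BG p (x, 0) + BG p (y, 0)" for x y
      using bilinear_mapD(1)[OF BG, of p "(x, 0)" "(y, 0)"] by simp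
    moreover have "BG p (sg c x, 0) = c * BG p (x, 0)" for c x
      using bilinear_mapD(3)[OF BG, of p c "(x, 0)"] by (simp add: sc)
    ultimately show ?thesis by unfold_locales (auto simp: algebra_simps)
  qed
  have "\<exists>x. \<forall>y. B x y = BG p (y, 0)" for p
    by (rule Riesz_representation[OF fd bil nd lin])
  then obtain h where h: "\<And>p y. B (h p) y = BG p (y, 0)" by metis
  have "Vector_Spaces.linear vs.scale sg h"
    by unfold_locales (rule eqI, simp add: h bilinear_mapD[OF bil] bilinear_mapD[OF BG])+
  with h have "is_h_map sg sv B BG h" by (simp add: is_h_map_def)
  moreover have "h' = h" if "is_h_map sg sv B BG h'" for h'
    using that h by (auto simp: is_h_map_def intro!: eqI)
  ultimately show ?thesis by blast
qed

lemma basis_family_coords: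
  assumes "vector_space s" and b: "basis_family s W r b"
  obtains \<alpha> where
    "\<And>x y i. x \<in> W \<Longrightarrow> y \<in> W \<Longrightarrow> \<alpha> i (x + y) = \<alpha> i x + \<alpha> i y"
    "\<And>x c i. x \<in> W \<Longrightarrow> \<alpha> i (s c x) = c * \<alpha> i x"
    "\<And>x. x \<in> W \<Longrightarrow> (\<Sum>i=1..r. s (\<alpha> i x) (b i)) = x"
    "\<And>i j. i \<in> {1..r} \<Longrightarrow> j \<in> {1..r} \<Longrightarrow> \<alpha> i (b j) = (if i = j then 1 else 0)"
proof -
  interpret vector_space s by fact
  let ?A = "b ` {1..r}"
  have inj: "inj_on b {1..r}" and ind: "independent ?A" and sp: "span ?A = W"
    using b by (auto simp: basis_family_def)
  show thesis
  proof (rule that[of "\<lambda>i x. representation ?A x (b i)"])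
    fix x y i assume "x \<in> W" "y \<in> W"
    then show "representation ?A (x + y) (b i) = representation ?A x (b i) + representation ?A y (b i)"
      using representation_add[OF ind] sp by simp
  next
    fix x c i assume "x \<in> W"
    then show "representation ?A (s c x) (b i) = c * representation ?A x (b i)"
      using representation_scale[OF ind] sp by simp
  next
    fix x assume "x \<in> W"
    then have "(\<Sum>v\<in>?A. s (representation ?A x v) v) = x"
      using sum_representation_eq[OF ind, of x ?A] sp by auto
    then show "(\<Sum>i=1..r. s (representation ?A x (b i)) (b i)) = x"
      unfolding sum.reindex[OF inj] by (simp add: o_def)
  next
    fix i j assume "i \<in> {1..r}" "j \<in> {1..r}"
    then show "representation ?A (b j) (b i) = (if i = j then 1 else 0)"
      unfolding representation_basis[OF ind imageI[OF \<open>j \<in> {1..r}\<close>]]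
      by (simp add: inj_on_eq_iff[OF inj])
  qed
qed

lemma form_G_ex1:
  fixes sg :: "'f::field \<Rightarrow> 'g::ab_group_add \<Rightarrow> 'g" and sv :: "'f \<Rightarrow> 'v::ab_group_add \<Rightarrow> 'v"
  assumes q: "quadratic_hom_lie_algebra sg \<mu> T B" and "vector_space sv"
    and ds: "direct_sum_decomp sg \<aa> (range T)"
    and a: "basis_family sg \<aa> r a" and v: "basis_family sv UNIV r v"
  shows "\<exists>!BG. is_form_G sg sv T B \<aa> r a v BG"
proof -
  have bil: "bilinear_form sg B" and fd: "finite_dim sg"
    and sym: "\<And>x y. B x y = B y x" and TB: "\<And>x y. B (T x) y = B x (T y)"
    and lT: "Vector_Spaces.linear sg sg T"
    using q unfolding quadratic_hom_lie_algebra_def hom_lie_algebra_def by blast+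
  have vg: "vector_space sg" using lT by (simp add: Vector_Spaces.linear_def)
  interpret G: vector_space sg by fact
  interpret T: Vector_Spaces.linear sg sg T by fact
  interpret vs: vector_space_prod sg sv
    using vg \<open>vector_space sv\<close> by (simp add: vector_space_prod_def vector_space_pair_def)
  have sub: "G.subspace \<aa>" and int: "\<aa> \<inter> range T = {0}"
    and dec: "\<And>x. \<exists>p w. p \<in> \<aa> \<and> x = p + T w"
    using ds unfolding direct_sum_decomp_def by blast+
  from dec obtain \<pi> \<tau> where \<pi>: "\<And>x. \<pi> x \<in> \<aa>" and pt: "\<And>x. \<pi> x + T (\<tau> x) = x"
    by metis
  have uniq: "p = p' \<and> T w = T w'" if "p \<in> \<aa>" "p' \<in> \<aa>" "p + T w = p' + T w'" for p p' w w'
  proof -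
    have "p - p' = T (w' - w)" using that(3) by (simp add: T.diff algebra_simps)
    moreover have "p - p' \<in> \<aa>" using that sub by (simp add: G.subspace_diff)
    ultimately have "p - p' \<in> \<aa> \<inter> range T" by auto
    then show ?thesis using int that(3) by auto
  qed
  have dec_add: "\<pi> (x + y) = \<pi> x + \<pi> y \<and> T (\<tau> (x + y)) = T (\<tau> x + \<tau> y)" for x y
  proof (rule uniq[OF \<pi>])
    show "\<pi> x + \<pi> y \<in> \<aa>" using \<pi> sub by (simp add: G.subspace_add)
    show "\<pi> (x + y) + T (\<tau> (x + y)) = \<pi> x + \<pi> y + T (\<tau> x + \<tau> y)"
      using pt[of "x + y"] pt[of x] pt[of y] by (simp add: T.add algebra_simps)
  qed
  have dec_scale: "\<pi> (sg c x) = sg c (\<pi> x) \<and> T (\<tau> (sg c x)) = T (sg c (\<tau> x))" for c x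
  proof (rule uniq[OF \<pi>])
    show "sg c (\<pi> x) \<in> \<aa>" using \<pi> sub by (simp add: G.subspace_scale)
    show "\<pi> (sg c x) + T (\<tau> (sg c x)) = sg c (\<pi> x) + T (sg c (\<tau> x))"
      using pt[of "sg c x"] pt[of x] by (metis T.scale G.scale_right_distrib)
  qed
  have \<pi>a: "\<pi> p = p \<and> T (\<tau> p) = T 0" if "p \<in> \<aa>" for p
    using that pt[of p] by (intro uniq[OF \<pi>]) (auto simp: T.zero)
  have \<pi>T: "\<pi> (T w) = 0 \<and> T (\<tau> (T w)) = T w" for w
    using pt[of "T w"] G.subspace_0[OF sub] by (intro uniq[OF \<pi>]) auto
  obtain \<alpha> where \<alpha>: "\<And>x y i. x \<in> \<aa> \<Longrightarrow> y \<in> \<aa> \<Longrightarrow> \<alpha> i (x + y) = \<alpha> i x + \<alpha> i y"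
    "\<And>x c i. x \<in> \<aa> \<Longrightarrow> \<alpha> i (sg c x) = c * \<alpha> i x"
    "\<And>x. x \<in> \<aa> \<Longrightarrow> (\<Sum>i=1..r. sg (\<alpha> i x) (a i)) = x"
    "\<And>i j. i \<in> {1..r} \<Longrightarrow> j \<in> {1..r} \<Longrightarrow> \<alpha> i (a j) = (if i = j then 1 else 0)"
    using basis_family_coords[OF vg a] by blast
  obtain \<omega> where \<omega>: "\<And>x y i. \<omega> i (x + y) = \<omega> i x + \<omega> i y"
    "\<And>x c i. \<omega> i (sv c x) = c * \<omega> i x"
    "\<And>x. (\<Sum>i=1..r. sv (\<omega> i x) (v i)) = x"
    "\<And>i j. i \<in> {1..r} \<Longrightarrow> j \<in> {1..r} \<Longrightarrow> \<omega> i (v j) = (if i = j then 1 else 0)"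
    using basis_family_coords[OF \<open>vector_space sv\<close> v, simplified UNIV_I True_implies_equals] by blast
  have \<alpha>0: "\<alpha> i 0 = 0" for i using \<alpha>(2)[of 0 i 0] G.subspace_0[OF sub] by simp
  have \<omega>0: "\<omega> i 0 = 0" for i using \<omega>(2)[of i 0 0] by simp
  have aa: "a i \<in> \<aa>" if "i \<in> {1..r}" for i
    using a that by (auto simp: basis_family_def intro: G.span_base)
  define BG where "BG p q = B (T (\<tau> (fst p))) (\<tau> (fst q)) +
      (\<Sum>i=1..r. \<alpha> i (\<pi> (fst p)) * \<omega> i (snd q)) + (\<Sum>i=1..r. \<alpha> i (\<pi> (fst q)) * \<omega> i (snd p))" for p q
  have BGsym: "BG p q = BG q p" for p q
    using trans[OF TB sym, of "\<tau> (fst p)" "\<tau> (fst q)"] by (simp add: BG_def add_ac)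
  have lin1: "Vector_Spaces.linear vs.scale (*) (\<lambda>p. BG p q)" for q
    by unfold_locales
       (simp_all add: BG_def vs.scale_def dec_add dec_scale T.add T.scale \<alpha> \<omega> \<pi> bilinear_mapD[OF bil]
          sum.distrib sum_distrib_left algebra_simps)
  then have lin2: "Vector_Spaces.linear vs.scale (*) (BG p)" for p
    using BGsym by (metis (no_types, lifting) ext)
  have form: "is_form_G sg sv T B \<aa> r a v BG"
    unfolding is_form_G_def
  proof (intro conjI allI ballI)
    show "bilinear_form vs.scale BG" using lin1 lin2 by (simp add: bilinear_map_def)
    show "BG p q = BG q p" for p q by (rule BGsym)
    show "BG (T x, 0) (T y, 0) = B (T x) y" for x y
      using \<pi>T by (simp add: BG_def \<alpha>0) (metis TB)
    show "BG (x, u) (T y, 0) = 0" if "x \<in> \<aa>" for x u y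
      using \<pi>T \<pi>a[OF that] by (simp add: BG_def \<alpha>0 \<omega>0 T.zero bilinear_mapD[OF bil])
    show "BG (x, 0) (y, 0) = 0" if "x \<in> \<aa>" "y \<in> \<aa>" for x y
      using \<pi>a[OF that(1)] by (simp add: BG_def \<omega>0 T.zero bilinear_mapD[OF bil])
    have 00: "\<pi> 0 = 0" "T (\<tau> 0) = 0"
      using \<pi>a[OF G.subspace_0[OF sub]] by (auto simp: T.zero)
    show "BG (0, u) (0, w) = 0" for u w
      by (simp add: BG_def 00 \<alpha>0 bilinear_mapD[OF bil])
    show "BG (a i, 0) (0, v j) = (if i = j then 1 else 0)" if "i \<in> {1..r}" "j \<in> {1..r}" for i j
    proof -
      have "BG (a i, 0) (0, v j) = (\<Sum>l=1..r. \<alpha> l (a i) * \<omega> l (v j))"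
        using \<pi>a[OF aa[OF that(1)]]
        by (simp add: BG_def 00 \<alpha>0 \<omega>0 T.zero bilinear_mapD[OF bil])
      also have "\<dots> = (\<Sum>l=1..r. if l = i then (if i = j then 1 else 0) else 0)"
        using that by (intro sum.cong refl) (auto simp: \<alpha>(4) \<omega>(4))
      also have "\<dots> = (if i = j then 1 else 0)" using that by simp
      finally show ?thesis .
    qed
  qed
  moreover have "BG1 = BG2" if f1: "is_form_G sg sv T B \<aa> r a v BG1"
    and f2: "is_form_G sg sv T B \<aa> r a v BG2" for BG1 BG2
  proof -
    have key: "F (x, u) (y, w) = B (T (\<tau> x)) (\<tau> y) +
        (\<Sum>i=1..r. \<Sum>j=1..r. \<alpha> i (\<pi> x) * \<omega> j w * (if i = j then 1 else 0)) +
        (\<Sum>i=1..r. \<Sum>j=1..r. \<alpha> i (\<pi> y) * \<omega> j u * (if i = j then 1 else 0))"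
      if F: "is_form_G sg sv T B \<aa> r a v F" for F x u y w
    proof -
      have Fb: "bilinear_form vs.scale F" and Fs: "\<And>p q. F p q = F q p"
        and F1: "\<And>x y. F (T x, 0) (T y, 0) = B (T x) y"
        and F2: "\<And>x u y. x \<in> \<aa> \<Longrightarrow> F (x, u) (T y, 0) = 0"
        and F3: "\<And>x y. x \<in> \<aa> \<Longrightarrow> y \<in> \<aa> \<Longrightarrow> F (x, 0) (y, 0) = 0"
        and F4: "\<And>u w. F (0, u) (0, w) = 0"
        and F5: "\<And>i j. i \<in> {1..r} \<Longrightarrow> j \<in> {1..r} \<Longrightarrow> F (a i, 0) (0, v j) = (if i = j then 1 else 0)"
        using F unfolding is_form_G_def by blast+
      have av: "F (x, 0) (0, w) =
          (\<Sum>i=1..r. \<Sum>j=1..r. \<alpha> i x * \<omega> j w * (if i = j then 1 else 0))" if "x \<in> \<aa>" for x w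
      proof -
        have l: "Vector_Spaces.linear vs.scale (*) (F p)"
          "Vector_Spaces.linear vs.scale (*) (\<lambda>p. F p q)" for p q
          using Fb unfolding bilinear_map_def by blast+
        have sL: "F (\<Sum>i=1..r. f i) q = (\<Sum>i=1..r. F (f i) q)" for f :: "nat \<Rightarrow> _" and q
          by (rule module_hom.sum[OF l(2)[unfolded linear_iff_module_hom]])
        have sR: "F p (\<Sum>i=1..r. f i) = (\<Sum>i=1..r. F p (f i))" for f :: "nat \<Rightarrow> _" and p
          by (rule module_hom.sum[OF l(1)[unfolded linear_iff_module_hom]])
        have e1: "(x, 0) = (\<Sum>i=1..r. vs.scale (\<alpha> i x) (a i, 0))"
          using \<alpha>(3)[OF that] by (simp add: vs.scale_def prod_eq_iff fst_sum snd_sum)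
        have e2: "(0, w) = (\<Sum>i=1..r. vs.scale (\<omega> i w) (0, v i))"
          using \<omega>(3)[of w] by (simp add: vs.scale_def prod_eq_iff fst_sum snd_sum)
        show ?thesis
        proof -
          have "F (x, 0) (0, w) = (\<Sum>i=1..r. \<alpha> i x * F (a i, 0) (0, w))"
            by (subst e1, simp only: sL bilinear_mapD[OF Fb])
          also have "\<dots> = (\<Sum>i=1..r. \<Sum>j=1..r. \<alpha> i x * \<omega> j w * F (a i, 0) (0, v j))"
            by (subst e2, simp only: sR bilinear_mapD[OF Fb] sum_distrib_left mult.assoc)
          also have "\<dots> = (\<Sum>i=1..r. \<Sum>j=1..r. \<alpha> i x * \<omega> j w * (if i = j then 1 else 0))"
            by (intro sum.cong refl) (simp only: F5)
          finally show ?thesis .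
        qed
      qed
      have dx: "(x, u) = (\<pi> x, 0) + (T (\<tau> x), 0) + (0, u)" for x and u :: 'v
        using pt[of x] by simp
      have F2': "F (T x, 0) (y, u) = 0" if "y \<in> \<aa>" for x y u
        using F2[OF that] Fs by metis
      have z: "0 \<in> \<aa>" using G.subspace_0[OF sub] .
      have va: "F (0, u) (x, 0) = F (x, 0) (0, u)" for u x by (rule Fs)
      show ?thesis
        by (subst dx[of x u], subst dx[of y w])
           (simp only: bilinear_mapD[OF Fb] F1 F2[OF \<pi>] F2[OF z] F2'[OF \<pi>] F2'[OF z] F3[OF \<pi> \<pi>]
             F4 va av[OF \<pi>] add_0 add_0_right add_ac)
    qed
    show ?thesis using key[OF f1] key[OF f2] by (intro ext) (metis surj_pair)
  qed
  ultimately show ?thesis by blast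
qed

end

theory Submission
  imports Defs
begin

text \<open>
  Testing against \<open>Im T\<close> and against the basis of \<open>\<aa>\<close> shows \<open>h \<circ> k = id\<close>, so \<open>k \<circ> h\<close> is a
  projection of \<open>\<GG>\<close> onto \<open>Im k = Im L\<close> along \<open>Ker h\<close>. The product is forced by (ii), and by skew
  symmetry its square is \<open>x\<^sup>2 = k (\<mu> (x, h x))\<close>. This vanishes trivially on \<open>Ker h\<close>; for
  \<open>x = k y\<close> it is \<open>k (\<mu> (T y, y)) = k (T (\<mu> (y, y))) = 0\<close> because \<open>T\<close> is in the centroid.
\<close>

lemma linear_k_map:
  assumes T: "Vector_Spaces.linear sg sg T" and sv: "vector_space sv" and B: "bilinear_form sg B"
  shows "Vector_Spaces.linear sg (module_prod.scale sg sv) (k_map sv T B r a v)"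
proof -
  have sg: "vector_space sg" using T by (simp add: Vector_Spaces.linear_def)
  interpret T: Vector_Spaces.linear sg sg T by fact
  interpret vs: vector_space_prod sg sv
    using sg sv by (simp add: vector_space_prod_def vector_space_pair_def)
  show ?thesis
    by unfold_locales
       (simp_all add: k_map_def vs.scale_def T.add T.scale bilinear_mapD[OF B]
          vs.vs2.scale_left_distrib sum.distrib vs.vs2.scale_sum_right)
qed

text \<open>The \<open>V\<close>-component of \<open>k_map\<close> restores what \<open>T\<close>
  loses. Since \<open>B\<close> is non-degenerate and \<open>h\<close> represents \<open>BG\<close>
  through \<open>B\<close>, it suffices to pair the image of \<open>x\<close> with every
  \<open>y\<close>. Against \<open>T w\<close> only the component \<open>T x\<close> counts, and
  self-adjointness of \<open>T\<close> gives \<open>B x (T w)\<close>. Against \<open>a j\<close>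
  only the \<open>V\<close>-component counts, and the duality of \<open>a\<close> and
  \<open>v\<close> under \<open>BG\<close> returns \<open>B (a j) x\<close>.\<close>

lemma h_k_map:
  fixes sg :: "'f::field \<Rightarrow> 'g::ab_group_add \<Rightarrow> 'g" and sv :: "'f \<Rightarrow> 'v::ab_group_add \<Rightarrow> 'v"
  assumes q: "quadratic_hom_lie_algebra sg \<mu> T B" and sv: "vector_space sv"
    and ds: "direct_sum_decomp sg \<aa> (range T)" and a: "basis_family sg \<aa> r a"
    and form: "is_form_G sg sv T B \<aa> r a v BG" and hm: "is_h_map sg sv B BG h"
  shows "h (k_map sv T B r a v x) = x"
proof -
  have B: "bilinear_form sg B" and Bs: "\<And>x y. B x y = B y x" and TB: "\<And>x y. B (T x) y = B x (T y)"
    and T: "Vector_Spaces.linear sg sg T" and nd: "\<And>x. (\<And>y. B x y = 0) \<Longrightarrow> x = 0"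
    using q unfolding quadratic_hom_lie_algebra_def hom_lie_algebra_def by blast+
  have sg: "vector_space sg" using T by (simp add: Vector_Spaces.linear_def)
  interpret G: vector_space sg by fact
  interpret vs: vector_space_prod sg sv
    using sg sv by (simp add: vector_space_prod_def vector_space_pair_def)
  \<comment> \<open>The field is viewed as a vector space over itself, so that linear functionals
    agreeing on the basis of \<open>\<aa>\<close> can be shown to agree on its span.\<close>
  interpret P: vector_space_pair sg "(*) :: 'f \<Rightarrow> 'f \<Rightarrow> 'f"
    by unfold_locales (simp_all add: algebra_simps)
  have F: "bilinear_form vs.scale BG" and Fs: "\<And>p q. BG p q = BG q p"
    and F1: "\<And>x y. BG (T x, 0) (T y, 0) = B (T x) y"
    and F2: "\<And>x u y. x \<in> \<aa> \<Longrightarrow> BG (x, u) (T y, 0) = 0"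
    and F5: "\<And>i j. i \<in> {1..r} \<Longrightarrow> j \<in> {1..r} \<Longrightarrow> BG (a i, 0) (0, v j) = (if i = j then 1 else 0)"
    using form unfolding is_form_G_def by blast+
  have hB: "\<And>p y. B (h p) y = BG p (y, 0)" using hm unfolding is_h_map_def by blast
  have sub: "G.subspace \<aa>" and dec: "\<And>y. \<exists>p w. p \<in> \<aa> \<and> y = p + T w"
    using ds unfolding direct_sum_decomp_def by blast+
  have sp: "G.span (a ` {1..r}) = \<aa>" using a by (simp add: basis_family_def)
  let ?u = "\<Sum>i=1..r. sv (B (a i) x) (v i)"
  have k: "k_map sv T B r a v x = (T x, 0) + (0, ?u)" by (simp add: k_map_def)
  \<comment> \<open>Taking \<open>0\<close> as the element of \<open>\<aa>\<close> in
    \<open>F2\<close> makes the \<open>V\<close>-component \<open>(0, ?u)\<close> orthogonal to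
    \<open>(T w, 0)\<close>.\<close>
  have on_image: "BG (k_map sv T B r a v x) (T w, 0) = B x (T w)" for w
    using F1[of x w] F2[of 0 ?u w] G.subspace_0[OF sub]
    by (simp only: k bilinear_mapD[OF F] TB add_0_right)
  have on_basis: "BG (k_map sv T B r a v x) (a j, 0) = B x (a j)" if j: "j \<in> {1..r}" for j
  proof -
    have aj: "a j \<in> \<aa>" using sp j by (auto intro: G.span_base)
    have lin: "Vector_Spaces.linear vs.scale (*) (BG (a j, 0))"
      using F by (simp add: bilinear_map_def)
    have "(0, ?u) = (\<Sum>i=1..r. vs.scale (B (a i) x) (0, v i))"
      by (simp add: vs.scale_def prod_eq_iff fst_sum snd_sum)
    then have "BG (a j, 0) (0, ?u) = (\<Sum>i=1..r. B (a i) x * BG (a j, 0) (0, v i))"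
      by (simp only: module_hom.sum[OF lin[unfolded linear_iff_module_hom]] bilinear_mapD[OF F])
    also have "\<dots> = (\<Sum>i=1..r. if i = j then B (a j) x else 0)"
      using j by (intro sum.cong refl) (auto simp: F5)
    also have "\<dots> = B (a j) x" using j by simp
    finally have "BG (0, ?u) (a j, 0) = B x (a j)" by (metis Fs Bs)
    moreover have "BG (T x, 0) (a j, 0) = 0" using F2[OF aj] Fs by metis
    ultimately show ?thesis by (simp only: k bilinear_mapD[OF F] add_0)
  qed
  have linB: "Vector_Spaces.linear sg (*) (B y)" for y
    using B by (simp add: bilinear_map_def)
  have agree: "B (h (k_map sv T B r a v x)) y = B x y" for y
  proof -
    obtain p w where p: "p \<in> \<aa>" and y: "y = p + T w" using dec by blast
    have "B (h (k_map sv T B r a v x)) p = B x p"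
    proof (rule P.linear_eq_on_span[OF linB linB])
      show "p \<in> G.span (a ` {1..r})" using p sp by simp
    qed (auto simp: hB on_basis)
    then show ?thesis using on_image[of w] by (simp add: y bilinear_mapD[OF B] hB)
  qed
  \<comment> \<open>Writing the difference with \<open>sg (-1) x\<close> lets additivity and
    homogeneity from \<open>bilinear_mapD\<close> expand it directly.\<close>
  have "B (h (k_map sv T B r a v x) + sg (-1) x) y = 0" for y
    using agree[of y] Bs by (simp only: bilinear_mapD[OF B]) simp
  then have "h (k_map sv T B r a v x) + sg (-1) x = 0" by (rule nd)
  then show ?thesis by simp
qed

text \<open>As \<open>k\<close> is a section of \<open>h\<close>, the composite of \<open>h\<close>
  followed by \<open>k\<close> is idempotent with kernel \<open>Ker h\<close> and image
  \<open>range k\<close>. The components of \<open>p\<close> are therefore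
  \<open>p - k (h p)\<close> and \<open>k (h p)\<close>.\<close>

lemma direct_sum_decomp_section:
  assumes h: "Vector_Spaces.linear s2 s1 h" and k: "Vector_Spaces.linear s1 s2 k"
    and hk: "\<And>x. h (k x) = x"
  shows "direct_sum_decomp s2 {p. h p = 0} (range k)"
proof -
  interpret h: Vector_Spaces.linear s2 s1 h by fact
  interpret k: Vector_Spaces.linear s1 s2 k by fact
  show ?thesis
    unfolding direct_sum_decomp_def
  proof (intro conjI allI)
    show "h.vs1.subspace {p. h p = 0}" by (rule h.subspace_kernel)
    show "h.vs1.subspace (range k)" by (rule k.subspace_image[OF h.vs2.subspace_UNIV])
    show "{p. h p = 0} \<inter> range k = {0}"
    proof (intro equalityI subsetI)
      show "p \<in> {p. h p = 0} \<inter> range k" if "p \<in> {0}" for p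
        using that k.zero by (auto simp: h.zero intro: range_eqI[where x = 0])
    qed (auto simp: hk k.zero)
    show "\<exists>u\<in>{p. h p = 0}. \<exists>w\<in>range k. p = u + w" for p
    proof (intro bexI)
      show "p = (p - k (h p)) + k (h p)" by simp
    qed (auto simp: h.diff hk)
  qed
qed

theorem proposition2p1:
  fixes sg :: "'f::{alg_closed_field,field_char_0} \<Rightarrow> 'g::ab_group_add \<Rightarrow> 'g"
    and sv :: "'f \<Rightarrow> 'v::ab_group_add \<Rightarrow> 'v"
    and \<mu> :: "'g \<Rightarrow> 'g \<Rightarrow> 'g" and T :: "'g \<Rightarrow> 'g" and B :: "'g \<Rightarrow> 'g \<Rightarrow> 'f"
    and \<aa> :: "'g set" and r :: nat and a :: "nat \<Rightarrow> 'g" and v :: "nat \<Rightarrow> 'v"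
    and BG :: "'g \<times> 'v \<Rightarrow> 'g \<times> 'v \<Rightarrow> 'f" and h :: "'g \<times> 'v \<Rightarrow> 'g"
  assumes "quadratic_hom_lie_algebra sg \<mu> T B"
    and "in_centroid \<mu> T"
    and "r = vector_space.dim sg {x. T x = 0}" and "r > 0"
    and "finite_dim sv" and "vector_space.dim sv UNIV = r"
    and "direct_sum_decomp sg \<aa> (range T)"
    and "basis_family sg \<aa> r a" and "basis_family sv UNIV r v"
    and "is_form_G sg sv T B \<aa> r a v BG"
    and "is_h_map sg sv B BG h"
  shows "\<exists>m :: 'g \<times> 'v \<Rightarrow> 'g \<times> 'v \<Rightarrow> 'g \<times> 'v.
    bilinear_map (module_prod.scale sg sv) (module_prod.scale sg sv) (module_prod.scale sg sv) m \<and>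
    (\<forall>x y. mu_G \<mu> x y = m x y - m y x) \<and>
    (\<forall>x y. module_prod.scale sg sv 2 (m x y) =
       mu_G \<mu> x y - bracket_G sv \<mu> T B r a v (h x, 0) y + bracket_G sv \<mu> T B r a v x (h y, 0)) \<and>
    (\<forall>x \<in> {x. h x = 0} \<union> range (L_map sv T B r a v). m x x = 0) \<and>
    direct_sum_decomp (module_prod.scale sg sv) {x. h x = 0} (range (L_map sv T B r a v))"
proof -
  note q = assms(1)
  have B: "bilinear_form sg B" and T: "Vector_Spaces.linear sg sg T"
    and M: "bilinear_map sg sg sg \<mu>" and skew: "\<And>x y. \<mu> x y = - \<mu> y x"
    using q unfolding quadratic_hom_lie_algebra_def hom_lie_algebra_def by blast+
  have cent: "\<And>x y. T (\<mu> x y) = \<mu> (T x) y" using assms(2) by (simp add: in_centroid_def)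
  have sg: "vector_space sg" using T by (simp add: Vector_Spaces.linear_def)
  have sv: "vector_space sv"
    using assms(5) by (auto simp: finite_dim_def finite_dimensional_vector_space_def)
  interpret G: vector_space sg by fact
  interpret T: Vector_Spaces.linear sg sg T by fact
  interpret vs: vector_space_prod sg sv
    using sg sv by (simp add: vector_space_prod_def vector_space_pair_def)
  define k where "k = k_map sv T B r a v"
  have lin_k: "Vector_Spaces.linear sg vs.scale k"
    unfolding k_def by (rule linear_k_map[OF T sv B])
  have lin_h: "Vector_Spaces.linear vs.scale sg h" using assms(11) by (simp add: is_h_map_def)
  interpret k: Vector_Spaces.linear sg vs.scale k by (rule lin_k)
  interpret h: Vector_Spaces.linear vs.scale sg h by (rule lin_h)
  have hk: "h (k x) = x" for x
    unfolding k_def by (rule h_k_map[OF q sv assms(7,8,10,11)])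
  have fst_k: "fst (k x) = T x" for x by (simp add: k_def k_map_def)
  \<comment> \<open>\<open>L_map\<close> is \<open>k\<close> after the first projection, which is
    onto.\<close>
  have range_L: "range (L_map sv T B r a v) = range k"
  proof (intro equalityI subsetI)
    show "p \<in> range (L_map sv T B r a v)" if "p \<in> range k" for p
      using that by (auto simp: L_map_def k_def intro: range_eqI[where x = "(x, 0)" for x])
  qed (auto simp: L_map_def k_def)
  have \<mu>0: "\<mu> x x = 0" for x
  proof -
    have "sg 2 (\<mu> x x) = \<mu> x x + \<mu> x x"
      using G.scale_left_distrib[of 1 1 "\<mu> x x"] by simp
    \<comment> \<open>Skew symmetry only yields twice the square; characteristic zero then allows
      division by 2.\<close>
    then have "sg 2 (\<mu> x x) = 0" using skew[of x x] by (metis add.right_inverse)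
    then show ?thesis by simp
  qed
  \<comment> \<open>\<open>d\<close> is the right-hand side of (ii) with the brackets unfolded
    through \<open>k\<close>. Halving it is the only possible choice of product.\<close>
  define d where "d x y = mu_G \<mu> x y - k (\<mu> (h x) (fst y)) + k (\<mu> (fst x) (h y))" for x y
  define m where "m x y = vs.scale (1/2) (d x y)" for x y
  have mu_G_bil:
    "mu_G \<mu> (x + x') y = mu_G \<mu> x y + (mu_G \<mu> x' y :: 'g \<times> 'v)"
    "mu_G \<mu> x (y + y') = mu_G \<mu> x y + (mu_G \<mu> x y' :: 'g \<times> 'v)"
    "mu_G \<mu> (vs.scale c x) y = vs.scale c (mu_G \<mu> x y)"
    "mu_G \<mu> x (vs.scale c y) = vs.scale c (mu_G \<mu> x y)" for x x' y y' c
    by (simp_all add: mu_G_def vs.scale_def bilinear_mapD[OF M])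
  have fst_scale_G: "fst (vs.scale c p) = sg c (fst p)" for c p by (simp add: vs.scale_def)
  have d_bil: "d (x + x') y = d x y + d x' y" "d x (y + y') = d x y + d x y'"
    "d (vs.scale c x) y = vs.scale c (d x y)" "d x (vs.scale c y) = vs.scale c (d x y)"
    for x x' y y' c
    by (simp_all add: d_def mu_G_bil bilinear_mapD[OF M] h.add h.scale k.add k.scale fst_scale_G
        vs.p.scale_right_distrib vs.p.scale_right_diff_distrib)
  have bil: "bilinear_map vs.scale vs.scale vs.scale m"
    unfolding bilinear_map_def m_def
    \<comment> \<open>\<open>mult.commute\<close> moves the factor 1/2 past an arbitrary
      scalar.\<close>
    by (intro conjI allI; unfold_locales)
       (simp_all add: d_bil vs.p.scale_right_distrib mult.commute)
  have two_m: "vs.scale 2 (m x y) = d x y" for x y by (simp add: m_def)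
  \<comment> \<open>By skew symmetry of \<open>\<mu>\<close>, the two \<open>k\<close>-terms of
    \<open>d x y\<close> together are symmetric in \<open>x\<close> and \<open>y\<close> and cancel,
    while the antisymmetric term \<open>mu_G\<close> doubles.\<close>
  have d_skew: "d x y - d y x = vs.scale 2 (mu_G \<mu> x y)" for x y
  proof -
    have "k (\<mu> (h y) (fst x)) = - k (\<mu> (fst x) (h y))" for x y :: "'g \<times> 'v"
      by (subst skew) (rule k.neg)
    moreover have "mu_G \<mu> y x = - (mu_G \<mu> x y :: 'g \<times> 'v)"
      using skew[of "fst y" "fst x"] by (simp add: mu_G_def)
    moreover have "vs.scale 2 p = p + p" for p
      using vs.p.scale_left_distrib[of 1 1 p] by simp
    ultimately show ?thesis by (simp add: d_def)
  qed
  have comm: "mu_G \<mu> x y = m x y - m y x" for x y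
    using d_skew[of x y]
    by (simp add: m_def flip: vs.p.scale_right_diff_distrib)
  have sq: "m x x = k (\<mu> (fst x) (h x))" for x
  proof -
    \<comment> \<open>On the diagonal the \<open>mu_G\<close> term vanishes and skew symmetry makes
      the two \<open>k\<close>-terms equal; their factor 2 is absorbed by the 1/2 in
      \<open>m\<close>.\<close>
    have "d x x = vs.scale 2 (k (\<mu> (fst x) (h x)))"
      using vs.p.scale_left_distrib[of 1 1 "k (\<mu> (fst x) (h x))"] skew[of "h x" "fst x"]
      by (simp add: d_def mu_G_def \<mu>0 k.neg flip: zero_prod_def)
    then show ?thesis by (simp add: m_def)
  qed
  have "m x x = 0" if "x \<in> {x. h x = 0} \<union> range k" for x
  proof (cases "h x = 0")
    case True
    then show ?thesis by (simp add: sq bilinear_mapD[OF M] k.zero)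
  next
    case False
    then obtain y where "x = k y" using \<open>x \<in> {x. h x = 0} \<union> range k\<close> by auto
    then show ?thesis by (simp add: sq hk fst_k \<mu>0 T.zero k.zero flip: cent)
  qed
  moreover have "direct_sum_decomp vs.scale {x. h x = 0} (range k)"
    by (rule direct_sum_decomp_section[OF lin_h lin_k hk])
  moreover have "vs.scale 2 (m x y) = mu_G \<mu> x y - bracket_G sv \<mu> T B r a v (h x, 0) y
      + bracket_G sv \<mu> T B r a v x (h y, 0)" for x y
    by (simp add: two_m d_def bracket_G_def k_def)
  ultimately show ?thesis using bil comm unfolding range_L by blast
qed

end
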